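(* Let $(\mathfrak{S},\mathfrak{C})$ be an EPRB-system, i.e. $\mathfrak{S}=\{(V_i,W_{i\oplus_4 1}):i\in\{1,\ldots,4\}\}$ and $\mathfrak{C}=\{\{V_i,W_i\}:i\in\{1,\ldots,4\}\}$. Then $$\Delta_0(\mathfrak{C})=\frac12\sum_{i=1}^4|\langle V_i\rangle-\langle W_i\rangle|,\qquad \Delta_{\min}(\mathfrak{S},\mathfrak{C})=\frac12\max\Big(2\Delta_0(\mathfrak{C}),\ \mathsf{s}_{odd}\big(\langle V_iW_{i\oplus_4 1}\rangle:i\in\{1,\ldots,4\}\big)-2\Big).$$ Consequently $$\mathsf{CNTX}(\mathfrak{S},\mathfrak{C})=\frac12\max\Big(0,\ \mathsf{s}_{odd}\big(\langle V_iW_{i\oplus_4 1}\rangle:i\in\{1,\ldots,4\}\big)-2-\sum_{i=1}^4|\langle V_i\rangle-\langle W_i\rangle|\Big),$$ and the system has a noncontextual description if and only if $$\mathsf{s}_{odd}\big(\langle V_iW_{i\oplus_4 1}\rangle:i\in\{1,\ldots,4\}\big)\le 2+\sum_{i=1}^4|\langle V_i\rangle-\langle W_i\rangle|.$$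
   Context: $\oplus_4$ denotes cyclic addition on $\{1,2,3,4\}$ ($4\oplus_4 1=1$). All $V_i,W_i$ are $\pm1$-valued random variables. Each pair $(V_i,W_{i\oplus_4 1})$ is jointly distributed, but variables in different pairs are stochastically unrelated (have no given joint distribution); in particular $V_i$ and $W_i$ are never jointly distributed. $\langle\cdot\rangle$ denotes expectation; $\langle V_iW_{i\oplus_4 1}\rangle$ is computed from the given joint distribution of the pair. A coupling of random variables $A,B$ is a jointly distributed pair $(A^*,B^* )$ with $A^*\sim A$, $B^*\sim B$; it is maximal if $\Pr[A^*=B^*]$ is the largest possible over all couplings. A coupling $S$ of $\mathfrak{S}$ is a jointly distributed 8-tuple $(V_1^*,\ldots,V_4^*,W_1^*,\ldots,W_4^* )$ with $(V_i^*,W_{i\oplus_4 1}^* )$ distributed as $(V_i,W_{i\oplus_4 1})$ for each $i$. The system has a (maximally) noncontextual description if some coupling $S$ has each $(V_i^*,W_i^* )$ a maximal coupling of $V_i,W_i$. $\Delta_0(\mathfrak{C})=\frac12\sum_i|\langle V_i\rangle-\langle W_i\rangle|$; $\Delta_{\min}(\mathfrak{S},\mathfrak{C})$ is the infimum over all couplings $S$ of $\sum_{i=1}^4\Pr[V_i^*\ne W_i^*]$; $\mathsf{CNTX}(\mathfrak{S},\mathfrak{C})=\Delta_{\min}(\mathfrak{S},\mathfrak{C})-\Delta_0(\mathfrak{C})$. For reals $a_1,\ldots,a_m$, $\mathsf{s}_{odd}(a_1,\ldots,a_m)$ is the maximum of $\sum_{i=1}^m(\pm a_i)$ over all sign choices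 with an odd number of minus signs. *)

theory Defs
  imports "HOL-Probability.Probability"
begin

definition nxt4 :: "nat \<Rightarrow> nat" where
  "nxt4 i = (if i = 4 then 1 else i + 1)"

definition prv4 :: "nat \<Rightarrow> nat" where
  "prv4 i = (if i = 1 then 4 else i - 1)"

text \<open>An EPRB system: P i is the joint distribution of the pair (V_i, W_(i+1)),
  both components +-1 valued.\<close>
definition eprb_system :: "(nat \<Rightarrow> (real \<times> real) pmf) \<Rightarrow> bool" where
  "eprb_system P \<longleftrightarrow> (\<forall>i\<in>{1..4}. set_pmf (P i) \<subseteq> {-1, 1} \<times> {-1, 1})"

definition distV :: "(nat \<Rightarrow> (real \<times> real) pmf) \<Rightarrow> nat \<Rightarrow> real pmf" where
  "distV P i = map_pmf fst (P i)"

definition distW :: "(nat \<Rightarrow> (real \<times> real) pmf) \<Rightarrow> nat \<Rightarrow> real pmf" where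
  "distW P i = map_pmf snd (P (prv4 i))"

definition meanV :: "(nat \<Rightarrow> (real \<times> real) pmf) \<Rightarrow> nat \<Rightarrow> real" where
  "meanV P i = measure_pmf.expectation (distV P i) (\<lambda>x. x)"

definition meanW :: "(nat \<Rightarrow> (real \<times> real) pmf) \<Rightarrow> nat \<Rightarrow> real" where
  "meanW P i = measure_pmf.expectation (distW P i) (\<lambda>x. x)"

definition corr :: "(nat \<Rightarrow> (real \<times> real) pmf) \<Rightarrow> nat \<Rightarrow> real" where
  "corr P i = measure_pmf.expectation (P i) (\<lambda>(x, y). x * y)"

text \<open>Couplings of the system: joint distributions of (V_1*,...,V_4*, W_1*,...,W_4*),
  encoded as a pmf on pairs of functions indexed by 1..4.\<close>
definition is_coupling :: "(nat \<Rightarrow> (real \<times> real) pmf) \<Rightarrow> ((nat \<Rightarrow> real) \<times> (nat \<Rightarrow> real)) pmf \<Rightarrow> bool" where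
  "is_coupling P S \<longleftrightarrow>
     (\<forall>i\<in>{1..4}. map_pmf (\<lambda>(v, w). (v i, w (nxt4 i))) S = P i)"

definition coupling_of :: "real pmf \<Rightarrow> real pmf \<Rightarrow> (real \<times> real) pmf \<Rightarrow> bool" where
  "coupling_of a b q \<longleftrightarrow> map_pmf fst q = a \<and> map_pmf snd q = b"

definition maximal_coupling :: "real pmf \<Rightarrow> real pmf \<Rightarrow> (real \<times> real) pmf \<Rightarrow> bool" where
  "maximal_coupling a b q \<longleftrightarrow> coupling_of a b q \<and>
     (\<forall>q'. coupling_of a b q' \<longrightarrow>
        measure_pmf.prob q' {(x, y). x = y} \<le> measure_pmf.prob q {(x, y). x = y})"

definition noncontextual :: "(nat \<Rightarrow> (real \<times> real) pmf) \<Rightarrow> bool" where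
  "noncontextual P \<longleftrightarrow> (\<exists>S. is_coupling P S \<and>
     (\<forall>i\<in>{1..4}. maximal_coupling (distV P i) (distW P i) (map_pmf (\<lambda>(v, w). (v i, w i)) S)))"

definition Delta0 :: "(nat \<Rightarrow> (real \<times> real) pmf) \<Rightarrow> real" where
  "Delta0 P = (1/2) * (\<Sum>i=1..4. \<bar>meanV P i - meanW P i\<bar>)"

definition Delta_min :: "(nat \<Rightarrow> (real \<times> real) pmf) \<Rightarrow> real" where
  "Delta_min P = Inf {(\<Sum>i=1..4. measure_pmf.prob S {(v, w). v i \<noteq> w i}) | S. is_coupling P S}"

definition CNTX :: "(nat \<Rightarrow> (real \<times> real) pmf) \<Rightarrow> real" where
  "CNTX P = Delta_min P - Delta0 P"

definition s_odd :: "real list \<Rightarrow> real" where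
  "s_odd as = Max {(\<Sum>i<length as. (if i \<in> M then - (as ! i) else as ! i)) | M.
                     M \<subseteq> {..<length as} \<and> odd (card M)}"

end

theory Submission
  imports Defs
begin

text \<open>
  The variables form the cycle $V_1, W_2, V_2, W_3, V_3, W_4, V_4, W_1$ in which the laws of the edges
  $V_i W_{i+1}$ are given and only the correlations $t_i$ of the edges $V_i W_i$ are free, with
  $\Pr[V_i \neq W_i] = (1 - t_i)/2$. For the lower bound, the product of the eight edge products
  is 1, so a signed sum of them with an odd number of minus signs is at most 6.

  Conversely, pair laws of signs along a cycle of length $N$ extend to a joint law as soon as all
  odd signed sums of correlations are at most $N - 2$: cut off a triangle by a chord, whose
  correlation has to lie in three intervals that meet pairwise (validity of the pair, the triangle,
  the shorter cycle), and glue. Taking $t_2, t_3, t_4$ maximal, a signed sum with a minus sign at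
  one of them never violates its bound, so $t_1$ has to be lowered only as far as the sums with
  plus signs on all $t_i$ demand, which is the stated value.
\<close>

section \<open>Pair laws of signs, described by means and correlation\<close>

text \<open>Three moments describe a pair law, which turns questions about the existence of joint
  laws into linear inequalities.\<close>

definition sign_pair :: "(real \<times> real) pmf \<Rightarrow> real \<Rightarrow> real \<Rightarrow> real \<Rightarrow> bool" where
  "sign_pair q x y e \<longleftrightarrow> set_pmf q \<subseteq> {-1, 1} \<times> {-1, 1} \<and>
     measure_pmf.expectation q fst = x \<and> measure_pmf.expectation q snd = y \<and>
     measure_pmf.expectation q (\<lambda>(s, t). s * t) = e"

text \<open>Nonnegativity of the four probabilities of a law with means \<open>x\<close>, \<open>y\<close> and correlation \<open>e\<close>.\<close>

definition sign_valid :: "real \<Rightarrow> real \<Rightarrow> real \<Rightarrow> bool" where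
  "sign_valid x y e \<longleftrightarrow> \<bar>x + y\<bar> \<le> 1 + e \<and> \<bar>x - y\<bar> \<le> 1 - e"

text \<open>Because |x + y| + |x - y| is twice the larger of |x| and |y|. This is the largest
  admissible correlation, the one of a maximal coupling.\<close>

lemma sign_valid_diff: "\<bar>x\<bar> \<le> 1 \<Longrightarrow> \<bar>y\<bar> \<le> 1 \<Longrightarrow> sign_valid x y (1 - \<bar>x - y\<bar>)"
  by (auto simp: sign_valid_def)

lemma expectation_signs:
  fixes f :: "real \<times> real \<Rightarrow> real"
  assumes "set_pmf q \<subseteq> {-1, 1} \<times> {-1, 1}"
  shows "measure_pmf.expectation q f =
    f (1, 1) * pmf q (1, 1) + f (1, -1) * pmf q (1, -1) +
    f (-1, 1) * pmf q (-1, 1) + f (-1, -1) * pmf q (-1, -1)"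
proof -
  have "measure_pmf.expectation q f = (\<Sum>z\<in>{-1, 1} \<times> {-1, 1}. f z * pmf q z)"
    using assms by (intro integral_measure_pmf_real) auto
  also have "{-1, 1} \<times> {-1, 1} = {(1, 1), (1, -1), (-1, 1), (-1, -1 :: real)} " by auto
  finally show ?thesis by (simp add: algebra_simps)
qed

text \<open>Walsh inversion: total mass, two means and correlation are four independent linear
  functionals of the four probabilities.\<close>

lemma sign_pair_iff_pmf:
  "sign_pair q x y e \<longleftrightarrow> set_pmf q \<subseteq> {-1, 1} \<times> {-1, 1} \<and>
     (\<forall>s\<in>{-1, 1}. \<forall>t\<in>{-1, 1}. pmf q (s, t) = (1 + s * x + t * y + s * t * e) / 4)"
proof (cases "set_pmf q \<subseteq> {-1, 1} \<times> {-1, 1}")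
  case True
  have "measure_pmf.expectation q (\<lambda>_. 1 :: real) = 1" by simp
  with True show ?thesis
    unfolding sign_pair_def expectation_signs[OF True] by (auto simp: field_simps)
qed (simp add: sign_pair_def)

lemma sign_pair_valid:
  assumes "sign_pair q x y e"
  shows "sign_valid x y e"
proof -
  have "0 \<le> (1 + s * x + t * y + s * t * e) / 4" if "s \<in> {-1, 1}" "t \<in> {-1, 1}" for s t
    using assms that by (metis sign_pair_iff_pmf pmf_nonneg)
  from this[of 1 1] this[of 1 "-1"] this[of "-1" 1] this[of "-1" "-1"]
  show ?thesis by (simp add: sign_valid_def abs_le_iff)
qed

lemma sign_pair_unique:
  assumes "sign_pair q x y e" "sign_pair q' x y e"
  shows "q = q'"
proof (rule pmf_eqI)
  fix z
  show "pmf q z = pmf q' z"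
  proof (cases "z \<in> {-1, 1} \<times> {-1, 1}")
    case True
    with assms show ?thesis by (auto simp: sign_pair_iff_pmf)
  next
    case False
    hence "z \<notin> set_pmf q" "z \<notin> set_pmf q'" using assms by (auto simp: sign_pair_def)
    thus ?thesis by (simp add: set_pmf_iff)
  qed
qed

section \<open>Triples of signs and gluing\<close>

lemma pmf_of_finite_weights:
  fixes f :: "'a \<Rightarrow> real"
  assumes "finite A" "\<forall>z\<in>A. 0 \<le> f z" "sum f A = 1"
  shows "\<exists>p. set_pmf p \<subseteq> A \<and> (\<forall>z\<in>A. pmf p z = f z)"
proof -
  define g where "g z = (if z \<in> A then f z else 0)" for z
  have g0: "0 \<le> g z" for z using assms by (simp add: g_def)
  have "(\<integral>\<^sup>+ z. ennreal (g z) \<partial>count_space UNIV) = (\<Sum>z\<in>A. ennreal (g z))"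
    using assms(1) by (intro nn_integral_count_space') (auto simp: g_def)
  also have "\<dots> = ennreal (\<Sum>z\<in>A. g z)" using g0 by (simp add: sum_ennreal)
  also have "\<dots> = 1" using assms by (simp add: g_def)
  finally have pmf: "pmf (embed_pmf g) z = g z" for z using g0 by (intro pmf_embed_pmf)
  hence "set_pmf (embed_pmf g) \<subseteq> A" by (auto simp: set_pmf_eq g_def)
  moreover have "\<forall>z\<in>A. pmf (embed_pmf g) z = f z" by (simp add: pmf g_def)
  ultimately show ?thesis by blast
qed

text \<open>The last hypothesis is the triangle condition on the correlations: the products
  \<open>a * b\<close> and \<open>a * c\<close> are signs with means \<open>p\<close> and
  \<open>r\<close>, and their product is \<open>b * c\<close> with mean \<open>q\<close>.\<close>

lemma sign_triple_exists:
  assumes "sign_valid x y p" "sign_valid y z q" "sign_valid x z r"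
    and "sign_valid p r q"
  obtains T :: "(real \<times> real \<times> real) pmf" where
    "sign_pair (map_pmf (\<lambda>(a, b, c). (a, b)) T) x y p"
    "sign_pair (map_pmf (\<lambda>(a, b, c). (b, c)) T) y z q"
    "sign_pair (map_pmf (\<lambda>(a, b, c). (a, c)) T) x z r"
proof -
  let ?A = "{-1, 1} \<times> {-1, 1} \<times> {-1, 1} :: (real \<times> real \<times> real) set"
  \<comment> \<open>The Walsh expansion of eight times the weight, without its third-order
    term.\<close>
  define h where "h a b c = 1 + a * x + b * y + c * z + a * b * p + b * c * q + a * c * r" for a b c
  \<comment> \<open>The third moment \<open>m\<close> is the only free parameter. It exists because two sign patterns of opposite
    parity differ in one place, giving a pair condition, or in all three, giving the triangle condition.\<close>
  define m where "m = min (min (h 1 1 (-1)) (h 1 (-1) 1)) (min (h (-1) 1 1) (h (-1) (-1) (-1)))"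
  define f where "f = (\<lambda>(a, b, c). (h a b c + a * b * c * m) / 8)"
  have A: "?A = {(1,1,1), (1,1,-1), (1,-1,1), (1,-1,-1), (-1,1,1), (-1,1,-1), (-1,-1,1), (-1,-1,-1)}"
    by auto
  have nonneg: "\<forall>w\<in>?A. 0 \<le> f w"
  proof -
    have "0 \<le> f (1,1,-1)" "0 \<le> f (1,-1,1)" "0 \<le> f (-1,1,1)" "0 \<le> f (-1,-1,-1)"
      by (auto simp: f_def m_def)
    moreover have opp: "0 \<le> h a b c + h a b (- c)" "0 \<le> h a b c + h a (- b) c"
      "0 \<le> h a b c + h (- a) b c" "0 \<le> h a b c + h (- a) (- b) (- c)"
      if "a \<in> {-1, 1}" "b \<in> {-1, 1}" "c \<in> {-1, 1}" for a b c
    proof -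
      have pair: "0 \<le> 1 + s * u + t * v + s * t * w"
        if "sign_valid u v w" "s \<in> {-1, 1}" "t \<in> {-1, 1}" for u v w s t
        using that by (auto simp: sign_valid_def abs_le_iff)
      have "h a b c + h a b (- c) = 2 * (1 + a * x + b * y + a * b * p)"
        "h a b c + h a (- b) c = 2 * (1 + a * x + c * z + a * c * r)"
        "h a b c + h (- a) b c = 2 * (1 + b * y + c * z + b * c * q)"
        "h a b c + h (- a) (- b) (- c) = 2 * (1 + a * b * p + b * c * q + a * c * r)"
        by (simp_all add: h_def algebra_simps)
      moreover have "0 \<le> 1 + (a * b) * p + (a * c) * r + (a * b) * (a * c) * q"
        using assms(4) that by (intro pair) auto
      hence "0 \<le> 1 + a * b * p + b * c * q + a * c * r" using that by auto
      ultimately show "0 \<le> h a b c + h a b (- c)" "0 \<le> h a b c + h a (- b) c"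
        "0 \<le> h a b c + h (- a) b c" "0 \<le> h a b c + h (- a) (- b) (- c)"
        using pair[OF assms(1), of a b] pair[OF assms(2), of b c] pair[OF assms(3), of a c] that by simp_all
    qed
    have "- h 1 1 1 \<le> m" "- h 1 (-1) (-1) \<le> m" "- h (-1) 1 (-1) \<le> m" "- h (-1) (-1) 1 \<le> m"
      using opp[of 1 1 1] opp[of 1 "-1" "-1"] opp[of "-1" 1 "-1"] opp[of "-1" "-1" 1]
      by (simp_all add: m_def)
    hence "0 \<le> f (1,1,1)" "0 \<le> f (1,-1,-1)" "0 \<le> f (-1,1,-1)" "0 \<le> f (-1,-1,1)"
      by (auto simp: f_def)
    ultimately show ?thesis unfolding A by blast
  qed
  have fin: "finite ?A" by simp
  have one: "sum f ?A = 1" unfolding A by (simp add: f_def h_def add_divide_distrib diff_divide_distrib)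
  obtain T where T: "set_pmf T \<subseteq> ?A" "\<forall>w\<in>?A. pmf T w = f w"
    using pmf_of_finite_weights[OF fin nonneg one] by (elim exE conjE)
  have sum8: "sum g ?A = g (1,1,1) + g (1,1,-1) + g (1,-1,1) + g (1,-1,-1) +
      g (-1,1,1) + g (-1,1,-1) + g (-1,-1,1) + g (-1,-1,-1)" for g :: "_ \<Rightarrow> real"
    unfolding A by simp
  have E: "measure_pmf.expectation T g = (\<Sum>w\<in>?A. g w * f w)" for g :: "_ \<Rightarrow> real"
  proof -
    have "measure_pmf.expectation T g = (\<Sum>w\<in>?A. g w * pmf T w)"
      using T(1) fin by (intro integral_measure_pmf_real) blast+
    also have "\<dots> = (\<Sum>w\<in>?A. g w * f w)" using T(2) by (intro sum.cong refl arg_cong2[of _ _ _ _ times]) (rule bspec)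
    finally show ?thesis .
  qed
  show thesis
  proof (rule that[of T])
    show "sign_pair (map_pmf (\<lambda>(a, b, c). (a, b)) T) x y p"
      "sign_pair (map_pmf (\<lambda>(a, b, c). (b, c)) T) y z q"
      "sign_pair (map_pmf (\<lambda>(a, b, c). (a, c)) T) x z r"
      using T(1) by (auto simp: sign_pair_def E sum8 f_def h_def add_divide_distrib diff_divide_distrib)
  qed
qed

text \<open>A triple whose third sign copies the second one.\<close>

lemma sign_pair_exists:
  assumes "sign_valid x y e"
  obtains q where "sign_pair q x y e"
proof -
  have "sign_valid y y 1" "sign_valid e e 1" using assms by (auto simp: sign_valid_def)
  with assms obtain T where "sign_pair (map_pmf (\<lambda>(a, b, c :: real). (a, b)) T) x y e"
    using sign_triple_exists[of x y e y 1 e] by auto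
  thus thesis by (rule that)
qed

text \<open>The joint law comes from \<open>rel_pmf\<close> of equality, pulled back along
  \<open>g\<close> and \<open>h\<close>. It serves to join two laws along a shared pair.\<close>

lemma pmf_gluing:
  assumes "map_pmf g p = map_pmf h q"
  obtains pq where "\<And>x y. (x, y) \<in> set_pmf pq \<Longrightarrow> g x = h y" "map_pmf fst pq = p" "map_pmf snd pq = q"
proof -
  have "rel_pmf (=) (map_pmf g p) (map_pmf h q)" using assms by (simp add: pmf.rel_eq)
  hence "rel_pmf (\<lambda>x y. g x = h y) p q" by (simp add: pmf.rel_map)
  thus thesis using that by (auto elim!: rel_pmf.cases)
qed

section \<open>Signed sums of correlations along a path\<close>

text \<open>The maximum of the sums of \<open>\<plusminus> e 0, \<dots>, \<plusminus> e n\<close> with an odd (\<open>b = True\<close>) or even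
  (\<open>b = False\<close>) number of minus signs and no minus sign at positions in \<open>T - {0}\<close>.\<close>

primrec parity_max :: "nat set \<Rightarrow> (nat \<Rightarrow> real) \<Rightarrow> bool \<Rightarrow> nat \<Rightarrow> real" where
  "parity_max T e b 0 = (if b then - e 0 else e 0)"
| "parity_max T e b (Suc n) = (if Suc n \<in> T then parity_max T e b n + e (Suc n)
     else max (parity_max T e b n + e (Suc n)) (parity_max T e (\<not> b) n - e (Suc n)))"

text \<open>A plus sign at an edge contributes at most 1 - |x i - x (i+1)|, a minus sign at most 1 -
  |x i + x (i+1)|. The triangle inequality along the path adds these distances up, and the parity of
  the minus signs decides between sum and difference of the end means.\<close>

lemma parity_max_endpoints:
  assumes "\<And>i. i \<le> n \<Longrightarrow> sign_valid (x i) (x (Suc i)) (e i)"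
  shows "parity_max {} e True n + \<bar>x 0 + x (Suc n)\<bar> \<le> real n + 1 \<and>
         parity_max {} e False n + \<bar>x 0 - x (Suc n)\<bar> \<le> real n + 1"
  using assms
proof (induction n)
  case 0
  thus ?case by (auto simp: sign_valid_def)
next
  case (Suc n)
  define od ev where "od = parity_max {} e True n" and "ev = parity_max {} e False n"
  have "od + \<bar>x 0 + x (Suc n)\<bar> \<le> real n + 1" "ev + \<bar>x 0 - x (Suc n)\<bar> \<le> real n + 1"
    using Suc by (auto simp: od_def ev_def)
  moreover have "\<bar>x (Suc n) + x (Suc (Suc n))\<bar> \<le> 1 + e (Suc n)"
      "\<bar>x (Suc n) - x (Suc (Suc n))\<bar> \<le> 1 - e (Suc n)"
    using Suc.prems[of "Suc n"] by (auto simp: sign_valid_def)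
  ultimately have
    "od + e (Suc n) + \<bar>x 0 + x (Suc (Suc n))\<bar> \<le> real n + 2"
    "ev - e (Suc n) + \<bar>x 0 + x (Suc (Suc n))\<bar> \<le> real n + 2"
    "ev + e (Suc n) + \<bar>x 0 - x (Suc (Suc n))\<bar> \<le> real n + 2"
    "od - e (Suc n) + \<bar>x 0 - x (Suc (Suc n))\<bar> \<le> real n + 2"
    by linarith+
  thus ?case by (auto simp: max_def simp flip: od_def ev_def)
qed

text \<open>Sums of opposite parity have opposite signs at some edge, where they cancel; each of the
  other \<open>n\<close> edges contributes at most 2.\<close>

lemma parity_max_add_le:
  assumes "\<And>i. i \<le> n \<Longrightarrow> sign_valid (x i) (x (Suc i)) (e i)"
  shows "parity_max {} e True n + parity_max {} e False n \<le> 2 * real n"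
  using assms
proof (induction n)
  case (Suc n)
  define od ev where "od = parity_max {} e True n" and "ev = parity_max {} e False n"
  have "od + ev \<le> 2 * real n" using Suc by (simp add: od_def ev_def)
  moreover have "od \<le> real n + 1" "ev \<le> real n + 1"
    using parity_max_endpoints[of n x e] Suc.prems by (auto simp: od_def ev_def)
  moreover have "\<bar>e (Suc n)\<bar> \<le> 1"
    using Suc.prems[of "Suc n"] by (auto simp: sign_valid_def)
  ultimately show ?case by (auto simp: max_def simp flip: od_def ev_def)
qed simp

text \<open>A minus sign at an edge of \<open>T\<close> contributes exactly |x i - x (i+1)| - 1. The
  triangle inequality round the cycle bounds this distance by the remaining ones and that of the end
  points, which gives the second argument of \<open>max\<close>.\<close>

lemma parity_max_restrict:
  assumes "\<And>i. i \<le> n \<Longrightarrow> sign_valid (x i) (x (Suc i)) (e i)"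
    and "\<And>i. i \<le> n \<Longrightarrow> i \<in> T \<Longrightarrow> e i = 1 - \<bar>x i - x (Suc i)\<bar>"
  shows "parity_max {} e True n \<le> max (parity_max T e True n) (real n - 1 + \<bar>x 0 - x (Suc n)\<bar>) \<and>
         parity_max {} e False n \<le> max (parity_max T e False n) (real n - 1 + \<bar>x 0 + x (Suc n)\<bar>)"
  using assms
proof (induction n)
  case (Suc n)
  define od ev od' ev' where "od = parity_max {} e True n" and "ev = parity_max {} e False n"
    and "od' = parity_max T e True n" and "ev' = parity_max T e False n"
  note defs = od_def ev_def od'_def ev'_def
  have "od \<le> max od' (real n - 1 + \<bar>x 0 - x (Suc n)\<bar>)"
      "ev \<le> max ev' (real n - 1 + \<bar>x 0 + x (Suc n)\<bar>)"
    using Suc by (auto simp: defs)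
  moreover have valid: "\<bar>x (Suc n) + x (Suc (Suc n))\<bar> \<le> 1 + e (Suc n)"
      "\<bar>x (Suc n) - x (Suc (Suc n))\<bar> \<le> 1 - e (Suc n)"
    using Suc.prems(1)[of "Suc n"] by (auto simp: sign_valid_def)
  ultimately have
    "od + e (Suc n) \<le> max (od' + e (Suc n)) (real n + \<bar>x 0 - x (Suc (Suc n))\<bar>)"
    "ev - e (Suc n) \<le> max (ev' - e (Suc n)) (real n + \<bar>x 0 - x (Suc (Suc n))\<bar>)"
    "ev + e (Suc n) \<le> max (ev' + e (Suc n)) (real n + \<bar>x 0 + x (Suc (Suc n))\<bar>)"
    "od - e (Suc n) \<le> max (od' - e (Suc n)) (real n + \<bar>x 0 + x (Suc (Suc n))\<bar>)"
    unfolding le_max_iff_disj by linarith+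
  \<comment> \<open>At an edge of \<open>T\<close> the restricted maximum has no minus sign, so that
    case must fall under the end point bound; maximality of the edge ensures this.\<close>
  moreover have
    "ev - e (Suc n) \<le> real n + \<bar>x 0 - x (Suc (Suc n))\<bar> \<and>
     od - e (Suc n) \<le> real n + \<bar>x 0 + x (Suc (Suc n))\<bar>" if "Suc n \<in> T"
  proof -
    have "od + \<bar>x 0 + x (Suc n)\<bar> \<le> real n + 1" "ev + \<bar>x 0 - x (Suc n)\<bar> \<le> real n + 1"
      using parity_max_endpoints[of n x e] Suc.prems(1) by (auto simp: defs)
    moreover have "e (Suc n) = 1 - \<bar>x (Suc n) - x (Suc (Suc n))\<bar>"
      using Suc.prems(2) that by simp
    ultimately show ?thesis by linarith
  qed
  ultimately show ?case by (auto simp: le_max_iff_disj simp flip: defs)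
qed simp

text \<open>For the chord from \<open>x\<close> to \<open>y\<close>, the interval given by validity
  of the pair meets the one given by the triangle with \<open>z\<close>.\<close>

lemma sign_valid_triangle:
  assumes "sign_valid y z f" "sign_valid x z r"
  shows "\<bar>f + r\<bar> + \<bar>x - y\<bar> \<le> 2" "\<bar>f - r\<bar> + \<bar>x + y\<bar> \<le> 2"
proof -
  have "y + z \<le> 1 + f" "- y - z \<le> 1 + f" "y - z \<le> 1 - f" "z - y \<le> 1 - f"
    "x + z \<le> 1 + r" "- x - z \<le> 1 + r" "x - z \<le> 1 - r" "z - x \<le> 1 - r"
    using assms by (simp_all add: sign_valid_def abs_le_iff)
  thus "\<bar>f + r\<bar> + \<bar>x - y\<bar> \<le> 2" "\<bar>f - r\<bar> + \<bar>x + y\<bar> \<le> 2" by linarith+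
qed

section \<open>Extension of pair laws along a cycle\<close>

text \<open>The closing edge has its own law \<open>c\<close>, so that the induction can put a chord
  in its place. The last two hypotheses bound the odd sums by the length n + 2 minus 2, split by the
  sign of \<open>r\<close>.\<close>

lemma cycle_coupling_exists:
  assumes "\<And>i. i \<le> n \<Longrightarrow> sign_pair (q i) (x i) (x (Suc i)) (e i)"
    and "sign_pair c (x 0) (x (Suc n)) r"
    and "parity_max {} e True n + r \<le> real n" "parity_max {} e False n - r \<le> real n"
  shows "\<exists>S :: (nat \<Rightarrow> real) pmf. (\<forall>i\<le>n. map_pmf (\<lambda>f. (f i, f (Suc i))) S = q i) \<and>
           map_pmf (\<lambda>f. (f 0, f (Suc n))) S = c"
  using assms
proof (induction n arbitrary: c r)
  case 0
  \<comment> \<open>With two vertices the cycle conditions force both edges to have the same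
    correlation.\<close>
  hence "r = e 0" by simp
  with 0 have "c = q 0" using sign_pair_unique by blast
  moreover have "map_pmf (\<lambda>f. (f 0, f (Suc 0))) (map_pmf (\<lambda>(a, b) i. if i = 0 then a else b) (q 0)) = q 0"
    by (simp add: map_pmf_comp case_prod_unfold)
  ultimately show ?case
    by (intro exI[of _ "map_pmf (\<lambda>(a, b) i. if i = 0 then a else b) (q 0)"]) simp
next
  case (Suc n)
  have valid: "sign_valid (x i) (x (Suc i)) (e i)" if "i \<le> Suc n" for i
    using sign_pair_valid Suc.prems(1) that by blast
  have valid_n: "sign_valid (x i) (x (Suc i)) (e i)" if "i \<le> n" for i
    using valid that by simp
  let ?od = "parity_max {} e True n" and ?ev = "parity_max {} e False n"
  let ?f = "e (Suc n)"
  \<comment> \<open>The largest lower end of the three intervals for the correlation of the chord.\<close>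
  define r' where "r' = max (max (\<bar>x 0 + x (Suc n)\<bar> - 1) (\<bar>?f + r\<bar> - 1)) (?ev - real n)"
  note v = valid[OF order.refl] sign_pair_valid[OF Suc.prems(2)]
  note ends = parity_max_endpoints[of n x e, OF valid_n] parity_max_add_le[of n x e, OF valid_n]
  have x: "\<bar>x 0\<bar> \<le> 1" "\<bar>x (Suc n)\<bar> \<le> 1" using v by (auto simp: sign_valid_def)
  have cyc: "?od + ?f + r \<le> real n + 1" "?ev - ?f + r \<le> real n + 1"
      "?ev + ?f - r \<le> real n + 1" "?od - ?f - r \<le> real n + 1"
    using Suc.prems(3,4) by (simp_all split: if_splits)
  have fr: "\<bar>?f\<bar> \<le> 1" "\<bar>r\<bar> \<le> 1" using v by (auto simp: sign_valid_def)
  have "\<bar>x 0 + x (Suc n)\<bar> + \<bar>x 0 - x (Suc n)\<bar> \<le> 2" "\<bar>?f + r\<bar> + \<bar>?f - r\<bar> \<le> 2"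
    using x fr by linarith+
  note bounds = this sign_valid_triangle[OF v]
  have "\<bar>?f - r\<bar> \<le> real n + 1 - ?ev" "\<bar>?f + r\<bar> \<le> real n + 1 - ?od"
    using cyc by (auto simp: abs_le_iff)
  \<comment> \<open>Each of the three lower ends lies below each of the three upper ends:
    \<open>cyc\<close> compares triangle and shorter cycle, \<open>ends\<close> validity and shorter
    cycle, \<open>sign_valid_triangle\<close> validity and triangle.\<close>
  hence "r' \<le> 1 - \<bar>x 0 - x (Suc n)\<bar> \<and> r' \<le> 1 - \<bar>?f - r\<bar> \<and> r' \<le> real n - ?od"
    using bounds ends unfolding r'_def max.bounded_iff by auto
  moreover have "\<bar>x 0 + x (Suc n)\<bar> - 1 \<le> r'" "\<bar>?f + r\<bar> - 1 \<le> r'" "?ev - real n \<le> r'"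
    by (simp_all add: r'_def)
  ultimately have r': "sign_valid (x 0) (x (Suc n)) r'" "sign_valid r' r ?f"
      "?od + r' \<le> real n" "?ev - r' \<le> real n"
    by (auto simp: sign_valid_def abs_le_iff)
  obtain T where T: "sign_pair (map_pmf (\<lambda>(a, b, c). (a, b)) T) (x 0) (x (Suc n)) r'"
      "sign_pair (map_pmf (\<lambda>(a, b, c). (b, c)) T) (x (Suc n)) (x (Suc (Suc n))) ?f"
      "sign_pair (map_pmf (\<lambda>(a, b, c). (a, c)) T) (x 0) (x (Suc (Suc n))) r"
    using sign_triple_exists[OF r'(1) v(1) v(2) r'(2)] by auto
  obtain S where S: "\<forall>i\<le>n. map_pmf (\<lambda>f. (f i, f (Suc i))) S = q i"
      "map_pmf (\<lambda>f. (f 0, f (Suc n))) S = map_pmf (\<lambda>(a, b, c). (a, b)) T"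
    using Suc.IH[OF _ T(1) r'(3,4)] Suc.prems(1) by auto
  obtain R where R: "\<And>f t. (f, t) \<in> set_pmf R \<Longrightarrow> (f 0, f (Suc n)) = (case t of (a, b, c) \<Rightarrow> (a, b))"
      "map_pmf fst R = S" "map_pmf snd R = T"
    using pmf_gluing[OF S(2)] by metis
  \<comment> \<open>Only the new vertex is overwritten, so the old edges keep their laws, while
    \<open>R\<close> identifies the ends of the chord with the first two signs of the
    triple.\<close>
  define U where "U = map_pmf (\<lambda>(f, a, b, c). f(Suc (Suc n) := c)) R"
  have "map_pmf (\<lambda>f. (f i, f (Suc i))) U = q i" if "i \<le> n" for i
  proof -
    have "map_pmf (\<lambda>f. (f i, f (Suc i))) U = map_pmf (\<lambda>f. (f i, f (Suc i))) (map_pmf fst R)"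
      using that by (auto simp: U_def map_pmf_comp case_prod_unfold)
    thus ?thesis using S(1) R(2) that by simp
  qed
  moreover have "map_pmf (\<lambda>f. (f (Suc n), f (Suc (Suc n)))) U = q (Suc n)"
  proof -
    have "map_pmf (\<lambda>f. (f (Suc n), f (Suc (Suc n)))) U = map_pmf (\<lambda>(a, b, c). (b, c)) (map_pmf snd R)"
      unfolding U_def map_pmf_comp by (rule map_pmf_cong) (auto dest!: R(1))
    thus ?thesis using T(2) Suc.prems(1)[of "Suc n"] R(3) sign_pair_unique by auto
  qed
  moreover have "map_pmf (\<lambda>f. (f 0, f (Suc (Suc n)))) U = c"
  proof -
    have "map_pmf (\<lambda>f. (f 0, f (Suc (Suc n)))) U = map_pmf (\<lambda>(a, b, c). (a, c)) (map_pmf snd R)"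
      unfolding U_def map_pmf_comp by (rule map_pmf_cong) (auto dest!: R(1))
    thus ?thesis using T(3) Suc.prems(2) R(3) sign_pair_unique by auto
  qed
  ultimately show ?case by (intro exI[of _ U]) (auto simp: le_Suc_eq)
qed

section \<open>Translation of the system and of maximal couplings\<close>

lemma s_odd_4:
  "s_odd [a, b, c, d] = Max {- a + b + c + d, a - b + c + d, a + b - c + d, a + b + c - d,
     a - b - c - d, - a + b - c - d, - a - b + c - d, - a - b - c + d}" (is "_ = Max ?X")
proof -
  define g where "g M = (\<Sum>i<4. if i \<in> M then - ([a, b, c, d] ! i) else [a, b, c, d] ! i)" for M
  have sum4: "sum h {..<4::nat} = h 0 + h 1 + h 2 + h 3" for h :: "nat \<Rightarrow> 'b :: comm_monoid_add"
    by (simp add: numeral_eq_Suc)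
  have g: "g M = (if 0 \<in> M then - a else a) + (if 1 \<in> M then - b else b) +
      (if 2 \<in> M then - c else c) + (if 3 \<in> M then - d else d)" for M
    unfolding g_def sum4 by simp
  have in_X: "g M \<in> ?X" if "M \<subseteq> {..<4}" "odd (card M)" for M
  proof -
    have "card M = (\<Sum>i<4. if i \<in> M then 1 else 0)"
      using that(1) by (simp add: sum.If_cases Int_absorb1)
    also have "\<dots> = (if 0 \<in> M then 1 else 0) + (if 1 \<in> M then 1 else 0) +
        (if 2 \<in> M then 1 else 0) + (if 3 \<in> M then 1 else 0)"
      by (rule sum4)
    finally show ?thesis using that(2) unfolding g
      by (cases "0 \<in> M"; cases "1 \<in> M"; cases "2 \<in> M"; cases "3 \<in> M") simp_all
  qed
  have "?X = g ` {{0}, {1}, {2}, {3}, {1, 2, 3}, {0, 2, 3}, {0, 1, 3}, {0, 1, 2}}"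
    by (simp add: g)
  also have "\<dots> \<subseteq> g ` {M. M \<subseteq> {..<4} \<and> odd (card M)}"
    by (intro image_mono) simp
  finally have "g ` {M. M \<subseteq> {..<4} \<and> odd (card M)} = ?X"
    using in_X by (intro subset_antisym image_subsetI) (elim CollectE conjE)
  moreover have len: "length [a, b, c, d] = 4" by simp
  have "s_odd [a, b, c, d] = Max (g ` {M. M \<subseteq> {..<4} \<and> odd (card M)})"
    unfolding s_odd_def len g_def setcompr_eq_image ..
  ultimately show ?thesis by (simp only:)
qed

lemma sign_pair_prob_neq:
  assumes "sign_pair q x y e"
  shows "measure_pmf.prob q {(s, t). s \<noteq> t} = (1 - e) / 2"
proof -
  have "measure_pmf.prob q {(s, t). s \<noteq> t} = measure_pmf.expectation q (indicator {(s, t). s \<noteq> t})"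
    by simp
  also have "\<dots> = pmf q (1, -1) + pmf q (-1, 1)"
    using assms by (subst expectation_signs) (auto simp: sign_pair_def)
  also have "\<dots> = (1 - e) / 2"
    using assms by (auto simp: sign_pair_iff_pmf field_simps)
  finally show ?thesis .
qed

lemma prv4_nxt4: "i \<in> {1..4} \<Longrightarrow> prv4 (nxt4 i) = i" "i \<in> {1..4} \<Longrightarrow> nxt4 (prv4 i) = i"
  "i \<in> {1..4} \<Longrightarrow> prv4 i \<in> {1..4}"
  by (auto simp: prv4_def nxt4_def)

lemma nxt4_values: "nxt4 (Suc 0) = 2" "nxt4 2 = 3" "nxt4 3 = 4" "nxt4 4 = 1"
  by (simp_all add: nxt4_def)

lemma eprb_sign_pair:
  assumes "eprb_system P" "i \<in> {1..4}"
  shows "sign_pair (P i) (meanV P i) (meanW P (nxt4 i)) (corr P i)"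
  using assms unfolding sign_pair_def meanV_def meanW_def corr_def distV_def distW_def
  by (simp only: prv4_nxt4 integral_map_pmf) (simp add: eprb_system_def)

lemma mean_abs_le_1:
  assumes "eprb_system P" "i \<in> {1..4}"
  shows "\<bar>meanV P i\<bar> \<le> 1" "\<bar>meanW P i\<bar> \<le> 1"
  using sign_pair_valid[OF eprb_sign_pair[OF assms]]
    sign_pair_valid[OF eprb_sign_pair[OF assms(1) prv4_nxt4(3)[OF assms(2)]]] prv4_nxt4(2)[OF assms(2)]
  by (auto simp: sign_valid_def)

lemma coupling_of_sign_pair:
  assumes "eprb_system P" "i \<in> {1..4}" "coupling_of (distV P i) (distW P i) q"
  shows "sign_pair q (meanV P i) (meanW P i) (measure_pmf.expectation q (\<lambda>(s, t). s * t))"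
proof -
  have "set_pmf (P i) \<subseteq> {-1, 1} \<times> {-1, 1}" "set_pmf (P (prv4 i)) \<subseteq> {-1, 1} \<times> {-1, 1}"
    using assms(1) assms(2) prv4_nxt4(3)[OF assms(2)] by (auto simp only: eprb_system_def)
  hence "set_pmf (distV P i) \<subseteq> {-1, 1}" "set_pmf (distW P i) \<subseteq> {-1, 1}"
    by (auto simp: distV_def distW_def)
  hence "set_pmf (map_pmf fst q) \<subseteq> {-1, 1}" "set_pmf (map_pmf snd q) \<subseteq> {-1, 1}"
    using assms(3) by (simp_all only: coupling_of_def)
  hence "set_pmf q \<subseteq> {-1, 1} \<times> {-1, 1}" by (force simp: image_subset_iff)
  moreover have "measure_pmf.expectation (map_pmf fst q) (\<lambda>x. x) = meanV P i"
    "measure_pmf.expectation (map_pmf snd q) (\<lambda>x. x) = meanW P i"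
    using assms(3) by (simp_all only: coupling_of_def meanV_def meanW_def)
  ultimately show ?thesis by (simp add: sign_pair_def)
qed

text \<open>The law of a sign is determined by its mean. Uniqueness of pair laws yields this when
  applied to diagonal pairs, whose correlation is 1.\<close>

lemma sign_pair_coupling_of:
  assumes "eprb_system P" "i \<in> {1..4}" "sign_pair q (meanV P i) (meanW P i) e"
  shows "coupling_of (distV P i) (distW P i) q"
proof -
  note V = eprb_sign_pair[OF assms(1,2)] and W = eprb_sign_pair[OF assms(1) prv4_nxt4(3)[OF assms(2)]]
  have sub: "set_pmf q \<subseteq> {-1, 1} \<times> {-1, 1}" "set_pmf (P i) \<subseteq> {-1, 1} \<times> {-1, 1}"
    "set_pmf (P (prv4 i)) \<subseteq> {-1, 1} \<times> {-1, 1}"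
    using assms(3) V W by (auto simp: sign_pair_def)
  have diag: "sign_pair (map_pmf (\<lambda>z. (g z, g z)) p) x x 1"
    if "set_pmf p \<subseteq> {-1, 1} \<times> {-1, 1}" "measure_pmf.expectation p g = x" "g = fst \<or> g = snd"
    for p x and g :: "real \<times> real \<Rightarrow> real"
  proof -
    have "measure_pmf.expectation p (\<lambda>z. g z * g z) = measure_pmf.expectation p (\<lambda>_. 1)"
      using that by (intro integral_cong_AE) (auto simp: AE_measure_pmf_iff)
    thus ?thesis using that by (auto simp: sign_pair_def)
  qed
  have "map_pmf (\<lambda>z. (fst z, fst z)) q = map_pmf (\<lambda>z. (fst z, fst z)) (P i)"
    using assms(3) V sub by (intro sign_pair_unique[OF diag diag]) (auto simp: sign_pair_def)
  hence "map_pmf fst (map_pmf (\<lambda>z. (fst z, fst z)) q) = map_pmf fst (map_pmf (\<lambda>z. (fst z, fst z)) (P i))"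
    by simp
  moreover have "map_pmf (\<lambda>z. (snd z, snd z)) q = map_pmf (\<lambda>z. (snd z, snd z)) (P (prv4 i))"
    using assms(3) W sub prv4_nxt4(2)[OF assms(2)]
    by (intro sign_pair_unique[OF diag diag]) (auto simp: sign_pair_def)
  hence "map_pmf snd (map_pmf (\<lambda>z. (snd z, snd z)) q) = map_pmf snd (map_pmf (\<lambda>z. (snd z, snd z)) (P (prv4 i)))"
    by simp
  ultimately show ?thesis by (simp add: coupling_of_def distV_def distW_def map_pmf_comp)
qed

lemma coupling_of_prob_neq_ge:
  assumes "eprb_system P" "i \<in> {1..4}" "coupling_of (distV P i) (distW P i) q"
  shows "\<bar>meanV P i - meanW P i\<bar> / 2 \<le> measure_pmf.prob q {(s, t). s \<noteq> t}"
  using sign_pair_prob_neq[OF coupling_of_sign_pair[OF assms]]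
    sign_pair_valid[OF coupling_of_sign_pair[OF assms]]
  by (simp add: sign_valid_def)

text \<open>The lower bound on the probability of a difference is attained by the law with the
  largest correlation, so maximal couplings are those that attain it.\<close>

lemma maximal_coupling_iff:
  assumes "eprb_system P" "i \<in> {1..4}"
  shows "maximal_coupling (distV P i) (distW P i) q \<longleftrightarrow> coupling_of (distV P i) (distW P i) q \<and>
    measure_pmf.prob q {(s, t). s \<noteq> t} = \<bar>meanV P i - meanW P i\<bar> / 2"
    (is "_ \<longleftrightarrow> ?c q \<and> ?p q = ?d / 2")
proof -
  have eq: "measure_pmf.prob q {(s, t). s = t} = 1 - ?p q" for q :: "(real \<times> real) pmf"
  proof -
    have "{(s, t). s = t} = UNIV - {(s :: real, t). s \<noteq> t}" by auto
    thus ?thesis using measure_pmf.prob_compl[of "{(s :: real, t). s \<noteq> t}" q] by simp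
  qed
  have "sign_valid (meanV P i) (meanW P i) (1 - ?d)"
    using mean_abs_le_1[OF assms] by (rule sign_valid_diff)
  then obtain q0 where q0: "sign_pair q0 (meanV P i) (meanW P i) (1 - ?d)"
    by (rule sign_pair_exists)
  have "?c q0" "?p q0 = ?d / 2"
    using sign_pair_coupling_of[OF assms q0] sign_pair_prob_neq[OF q0] by simp_all
  with coupling_of_prob_neq_ge[OF assms] show ?thesis
    unfolding maximal_coupling_def eq by force
qed

lemma is_coupling_coupling_of:
  assumes "is_coupling P S" "i \<in> {1..4}"
  shows "coupling_of (distV P i) (distW P i) (map_pmf (\<lambda>(v, w). (v i, w i)) S)"
proof -
  have "P i = map_pmf (\<lambda>(v, w). (v i, w (nxt4 i))) S"
    "P (prv4 i) = map_pmf (\<lambda>(v, w). (v (prv4 i), w (nxt4 (prv4 i)))) S"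
    using assms prv4_nxt4(3)[OF assms(2)] by (simp_all only: is_coupling_def)
  thus ?thesis using prv4_nxt4(2)[OF assms(2)]
    by (simp add: coupling_of_def distV_def distW_def map_pmf_comp case_prod_unfold)
qed

lemma prob_neq_map:
  "measure_pmf.prob S {(v, w). v i \<noteq> w i} =
   measure_pmf.prob (map_pmf (\<lambda>(v, w). (v i, w i)) S) {(s, t). s \<noteq> t}"
  by (simp add: vimage_def case_prod_unfold)

section \<open>Lower bound for all couplings\<close>

lemma odd_signs_sum_le:
  fixes g :: "nat \<Rightarrow> real"
  assumes "\<And>i. i < n \<Longrightarrow> g i \<in> {-1, 1}" "(\<Prod>i<n. g i) = -1"
  shows "(\<Sum>i<n. g i) \<le> real n - 2"
proof -
  have "\<exists>j<n. g j \<noteq> 1"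
  proof (rule ccontr)
    assume "\<not> (\<exists>j<n. g j \<noteq> 1)"
    hence "(\<Prod>i<n. g i) = 1" by (intro prod.neutral) auto
    with assms(2) show False by simp
  qed
  then obtain j where j: "j < n" "g j = -1" using assms(1) by blast
  have "(\<Sum>i\<in>{..<n} - {j}. g i) \<le> (\<Sum>i\<in>{..<n} - {j}. 1)"
    using assms(1) by (intro sum_mono) force
  thus ?thesis using j by (simp add: sum.remove[of "{..<n}" j] of_nat_diff)
qed

lemma is_coupling_s_odd_le:
  assumes "eprb_system P" "is_coupling P S"
  shows "s_odd [corr P 1, corr P 2, corr P 3, corr P 4] \<le>
    2 + 2 * (\<Sum>i=1..4. measure_pmf.prob S {(v, w). v i \<noteq> w i})"
proof -
  define m where "m i = measure_pmf.expectation S (\<lambda>(v, w). v i * w i)" for i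
  have four: "{Suc 0..4} = {1, 2, 3, 4}" by auto
  have pair: "sign_pair (map_pmf (\<lambda>(v, w). (v i, w i)) S) (meanV P i) (meanW P i) (m i)" if "i \<in> {1..4}" for i
    using coupling_of_sign_pair[OF assms(1) that is_coupling_coupling_of[OF assms(2) that]]
    by (simp add: m_def case_prod_unfold)
  have P: "P i = map_pmf (\<lambda>(v, w). (v i, w (nxt4 i))) S" if "i \<in> {1..4}" for i
    using assms(2) that by (simp only: is_coupling_def)
  have corr: "corr P i = measure_pmf.expectation S (\<lambda>(v, w). v i * w (nxt4 i))" if "i \<in> {1..4}" for i
    using P[OF that] by (simp add: corr_def case_prod_unfold)
  have signs: "v i \<in> {-1, 1} \<and> w i \<in> {-1, 1}" if "(v, w) \<in> set_pmf S" "i \<in> {1..4}" for v w i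
    using pair[OF that(2)] that(1) by (auto simp: sign_pair_def)
  \<comment> \<open>\<open>S\<close> may have infinite support, as its functions are unconstrained
    outside 1..4; integrability comes from boundedness.\<close>
  have int: "integrable S (\<lambda>(v, w). v i * w j)" if "i \<in> {1..4}" "j \<in> {1..4}" for i j
  proof (rule measure_pmf.integrable_const_bound[of _ 1])
    show "AE z in S. norm (case z of (v, w) \<Rightarrow> v i * w j) \<le> 1"
    proof (rule AE_pmfI)
      fix z assume "z \<in> set_pmf S"
      then obtain v w where z: "z = (v, w)" "(v, w) \<in> set_pmf S" by (cases z) auto
      have "\<bar>v i\<bar> = 1" "\<bar>w j\<bar> = 1" using signs[OF z(2) that(1)] signs[OF z(2) that(2)] by auto
      thus "norm (case z of (v, w) \<Rightarrow> v i * w j) \<le> 1" by (simp add: z(1) abs_mult)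
    qed
  qed simp
  \<comment> \<open>The four free edges get plus signs. The whole sum has expectation at most 6, and
    the \<open>m i\<close> add up to 4 minus twice the sum of the probabilities.\<close>
  have key: "s1 * corr P 1 + s2 * corr P 2 + s3 * corr P 3 + s4 * corr P 4 \<le>
     2 + 2 * (\<Sum>i=1..4. measure_pmf.prob S {(v, w). v i \<noteq> w i})"
    if s: "s1 \<in> {-1, 1}" "s2 \<in> {-1, 1}" "s3 \<in> {-1, 1}" "s4 \<in> {-1, 1}" "s1 * s2 * s3 * s4 = -1"
    for s1 s2 s3 s4
  proof -
    let ?g = "\<lambda>(v, w). s1 * (v 1 * w 2) + s2 * (v 2 * w 3) + s3 * (v 3 * w 4) + s4 * (v 4 * w 1) +
      v 1 * w 1 + v 2 * w 2 + v 3 * w 3 + v 4 * w 4"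
    have le: "?g (v, w) \<le> 6" if vw: "(v, w) \<in> set_pmf S" for v w
    proof -
      let ?l = "[s1 * (v 1 * w 2), s2 * (v 2 * w 3), s3 * (v 3 * w 4), s4 * (v 4 * w 1),
        v 1 * w 1, v 2 * w 2, v 3 * w 3, v 4 * w 4]"
      have vs: "v i * v i = 1" "w i * w i = 1" if "i \<in> {1..4}" for i
        using signs[OF vw that] by auto
      have "?l ! i \<in> {-1, 1}" if "i < 8" for i
      proof -
        have mult: "y * z \<in> {-1, 1}" if "y \<in> {-1, 1}" "z \<in> {-1, 1}" for y z :: real
          using that by auto
        have "set ?l \<subseteq> {-1, 1}" unfolding list.set
          by (intro insert_subsetI empty_subsetI mult s
              signs[OF vw, THEN conjunct1] signs[OF vw, THEN conjunct2]) simp_all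
        moreover have "?l ! i \<in> set ?l" using that by (intro nth_mem) simp
        ultimately show ?thesis by blast
      qed
      \<comment> \<open>Every variable lies on two edges of the cycle, so only squares and the
        product of the chosen signs remain.\<close>
      moreover have "(\<Prod>i<8. ?l ! i) = (s1 * s2 * s3 * s4) *
          (v 1 * v 1) * (v 2 * v 2) * (v 3 * v 3) * (v 4 * v 4) *
          (w 1 * w 1) * (w 2 * w 2) * (w 3 * w 3) * (w 4 * w 4)"
        by (simp add: numeral_eq_Suc)
      hence "(\<Prod>i<8. ?l ! i) = -1" using s(5) vs by simp
      ultimately have "(\<Sum>i<8. ?l ! i) \<le> real 8 - 2" by (intro odd_signs_sum_le)
      thus ?thesis by (simp add: numeral_eq_Suc)
    qed
    have "measure_pmf.expectation S ?g \<le> measure_pmf.expectation S (\<lambda>_. 6)"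
      using le int by (intro integral_mono_AE) (auto simp: AE_measure_pmf_iff case_prod_unfold)
    moreover have "measure_pmf.expectation S ?g = s1 * corr P 1 + s2 * corr P 2 + s3 * corr P 3 + s4 * corr P 4 +
       m 1 + m 2 + m 3 + m 4"
      using int by (simp add: corr m_def case_prod_unfold nxt4_values)
    moreover have neq: "measure_pmf.prob S {(v, w). v i \<noteq> w i} = (1 - m i) / 2" if "i \<in> {1..4}" for i
      unfolding prob_neq_map using sign_pair_prob_neq[OF pair[OF that]] .
    have "2 * (\<Sum>i=1..4. measure_pmf.prob S {(v, w). v i \<noteq> w i}) = (\<Sum>i=1..4. 1 - m i)"
      unfolding sum_distrib_left by (intro sum.cong refl) (simp add: neq)
    hence "2 * (\<Sum>i=1..4. measure_pmf.prob S {(v, w). v i \<noteq> w i}) = 4 - m 1 - m 2 - m 3 - m 4"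
      by (simp add: four)
    ultimately show ?thesis by simp
  qed
  define B where "B = 2 + 2 * (\<Sum>i=1..4. measure_pmf.prob S {(v, w). v i \<noteq> w i})"
  let ?a = "corr P 1" and ?b = "corr P 2" and ?c = "corr P 3" and ?d = "corr P 4"
  note key' = key[folded B_def]
  have "- ?a + ?b + ?c + ?d \<le> B" using key'[of "-1" 1 1 1] by simp
  moreover have "?a - ?b + ?c + ?d \<le> B" using key'[of 1 "-1" 1 1] by simp
  moreover have "?a + ?b - ?c + ?d \<le> B" using key'[of 1 1 "-1" 1] by simp
  moreover have "?a + ?b + ?c - ?d \<le> B" using key'[of 1 1 1 "-1"] by simp
  moreover have "?a - ?b - ?c - ?d \<le> B" using key'[of 1 "-1" "-1" "-1"] by simp
  moreover have "- ?a + ?b - ?c - ?d \<le> B" using key'[of "-1" 1 "-1" "-1"] by simp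
  moreover have "- ?a - ?b + ?c - ?d \<le> B" using key'[of "-1" "-1" 1 "-1"] by simp
  moreover have "- ?a - ?b - ?c + ?d \<le> B" using key'[of "-1" "-1" "-1" 1] by simp
  ultimately show ?thesis unfolding s_odd_4 B_def[symmetric]
    by (intro Max.boundedI) (simp_all only: finite_insert finite.emptyI insert_not_empty not_False_eq_True,
      elim insertE emptyE, simp_all only:)
qed

section \<open>A coupling that attains the bound\<close>

lemma optimal_coupling_exists:
  assumes "eprb_system P"
  obtains S where "is_coupling P S"
    "(\<Sum>i=1..4. measure_pmf.prob S {(v, w). v i \<noteq> w i}) \<le>
      1/2 * max (2 * Delta0 P) (s_odd [corr P 1, corr P 2, corr P 3, corr P 4] - 2)"
proof -
  define a b c where "a = meanV P" and "b = meanW P" and "c = corr P"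
  define t where "t i = 1 - \<bar>b i - a i\<bar>" for i
  have four: "{Suc 0..4} = {1, 2, 3, 4}" by auto
  have pairs: "sign_pair (P 1) (a 1) (b 2) (c 1)" "sign_pair (P 2) (a 2) (b 3) (c 2)"
    "sign_pair (P 3) (a 3) (b 4) (c 3)" "sign_pair (P 4) (a 4) (b 1) (c 4)"
    using eprb_sign_pair[OF assms, of 1] eprb_sign_pair[OF assms, of 2]
      eprb_sign_pair[OF assms, of 3] eprb_sign_pair[OF assms, of 4]
    by (simp_all add: a_def b_def c_def nxt4_values)
  have bounds: "\<bar>a i\<bar> \<le> 1" "\<bar>b i\<bar> \<le> 1" if "i \<in> {1..4}" for i
    using mean_abs_le_1[OF assms that] by (simp_all add: a_def b_def)
  have valid_t: "sign_valid (b 2) (a 2) (t 2)" "sign_valid (b 3) (a 3) (t 3)" "sign_valid (b 4) (a 4) (t 4)"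
    using bounds unfolding t_def by (auto intro!: sign_valid_diff)
  obtain q2 q3 q4 where q: "sign_pair q2 (b 2) (a 2) (t 2)" "sign_pair q3 (b 3) (a 3) (t 3)"
    "sign_pair q4 (b 4) (a 4) (t 4)"
    using valid_t by (meson sign_pair_exists)
  \<comment> \<open>The vertices in cyclic order. \<open>V_1\<close> is at 0 and \<open>W_1\<close>
    at 7, so that the adjustable edge closes the cycle.\<close>
  define x where "x = nth [a 1, b 2, a 2, b 3, a 3, b 4, a 4, b 1]"
  define e where "e = nth [c 1, t 2, c 2, t 3, c 3, t 4, c 4]"
  define q where "q = nth [P 1, q2, P 2, q3, P 3, q4, P 4]"
  have seven: "i \<in> {0, 1, 2, 3, 4, 5, 6}" if "i \<le> 6" for i :: nat using that by auto
  have q_pair: "sign_pair (q i) (x i) (x (Suc i)) (e i)" if "i \<le> 6" for i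
    using seven[OF that] pairs q by (auto simp: q_def x_def e_def numeral_eq_Suc)
  note valid = sign_pair_valid[OF q_pair]
  have x07: "x 0 = a 1" "x (Suc 6) = b 1" by (simp_all add: x_def)
  define od ev where "od = parity_max {} e True 6" and "ev = parity_max {} e False 6"
  \<comment> \<open>The largest correlation of \<open>V_1\<close> and \<open>W_1\<close> compatible
    with validity and with the odd sums that have a plus sign there.\<close>
  define r where "r = min (1 - \<bar>a 1 - b 1\<bar>) (6 - od)"
  have ends: "od + \<bar>a 1 + b 1\<bar> \<le> 7" "ev + \<bar>a 1 - b 1\<bar> \<le> 7" "od + ev \<le> 12"
    using parity_max_endpoints[of 6 x e] parity_max_add_le[of 6 x e] valid
    unfolding x07 od_def ev_def by auto
  have "sign_valid (a 1) (b 1) (1 - \<bar>a 1 - b 1\<bar>)" using bounds by (auto intro!: sign_valid_diff)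
  hence "sign_valid (a 1) (b 1) r" using ends(1) by (auto simp: sign_valid_def r_def min_def)
  then obtain q1 where q1: "sign_pair q1 (x 0) (x (Suc 6)) r" unfolding x07 by (rule sign_pair_exists)
  have "od + r \<le> real 6" "ev - r \<le> real 6" using ends by (auto simp: r_def min_def)
  then obtain F :: "(nat \<Rightarrow> real) pmf" where F: "\<forall>i\<le>6. map_pmf (\<lambda>f. (f i, f (Suc i))) F = q i"
      "map_pmf (\<lambda>f. (f 0, f (Suc 6))) F = q1"
    using cycle_coupling_exists[OF q_pair q1] unfolding od_def ev_def by blast
  \<comment> \<open>\<open>W_1\<close> is an exception: truncated subtraction would send it to 0,
    the place of \<open>V_1\<close>.\<close>
  define S where "S = map_pmf (\<lambda>f. (\<lambda>i. f (2 * i - 2), \<lambda>i. if i = 1 then f 7 else f (2 * i - 3))) F"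
  have "is_coupling P S"
    using F(1)[rule_format, of 0] F(1)[rule_format, of 2] F(1)[rule_format, of 4] F(1)[rule_format, of 6]
    by (simp add: is_coupling_def four S_def map_pmf_comp nxt4_values q_def)
  have neq: "measure_pmf.prob F {f. f i \<noteq> f (Suc i)} = (1 - e i) / 2" if "i \<le> 6" for i
  proof -
    have "measure_pmf.prob (map_pmf (\<lambda>f. (f i, f (Suc i))) F) {(s, t). s \<noteq> t} = (1 - e i) / 2"
      using sign_pair_prob_neq[OF q_pair[OF that]] F(1) that by simp
    thus ?thesis by (simp add: vimage_def)
  qed
  have "measure_pmf.prob S {(v, w). v 1 \<noteq> w 1} = (1 - r) / 2"
    using sign_pair_prob_neq[OF q1] unfolding F(2)[symmetric] by (simp add: S_def vimage_def)
  moreover have "measure_pmf.prob S {(v, w). v 2 \<noteq> w 2} = (1 - t 2) / 2"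
    using neq[of 1] by (simp add: S_def vimage_def e_def eq_commute numeral_eq_Suc)
  moreover have "measure_pmf.prob S {(v, w). v 3 \<noteq> w 3} = (1 - t 3) / 2"
    using neq[of 3] by (simp add: S_def vimage_def e_def eq_commute numeral_eq_Suc)
  moreover have "measure_pmf.prob S {(v, w). v 4 \<noteq> w 4} = (1 - t 4) / 2"
    using neq[of 5] by (simp add: S_def vimage_def e_def eq_commute numeral_eq_Suc)
  ultimately have sum: "(\<Sum>i=1..4. measure_pmf.prob S {(v, w). v i \<noteq> w i}) = (4 - r - t 2 - t 3 - t 4) / 2"
    by (simp add: four)
  let ?T = "{1, 3, 5 :: nat}"
  have "e i = 1 - \<bar>x i - x (Suc i)\<bar>" if "i \<in> ?T" for i
    using that by (auto simp: e_def x_def t_def numeral_eq_Suc)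
  \<comment> \<open>The second bound equals 6 minus the maximal correlation of \<open>V_1\<close>
    and \<open>W_1\<close>, so sums with a minus sign in \<open>?T\<close> never force
    \<open>r\<close> below that value.\<close>
  hence "od \<le> max (parity_max ?T e True 6) (5 + \<bar>a 1 - b 1\<bar>)"
    using parity_max_restrict[of 6 x e ?T] valid unfolding x07 od_def by auto
  moreover have "parity_max ?T e True 6 \<le> s_odd [c 1, c 2, c 3, c 4] + t 2 + t 3 + t 4"
    unfolding s_odd_4 by (simp add: numeral_eq_Suc e_def max_def)
  moreover have "2 * Delta0 P = \<bar>a 1 - b 1\<bar> + 3 - t 2 - t 3 - t 4"
    by (simp add: Delta0_def four t_def abs_minus_commute a_def b_def)
  ultimately have "(4 - r - t 2 - t 3 - t 4) / 2 \<le> 1/2 * max (2 * Delta0 P) (s_odd [c 1, c 2, c 3, c 4] - 2)"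
    unfolding r_def by (simp add: min_def max_def split: if_splits)
  with \<open>is_coupling P S\<close> show thesis unfolding sum[symmetric] c_def by (rule that)
qed

section \<open>The minimum and the criterion for noncontextuality\<close>

theorem theorem35:
  fixes P :: "nat \<Rightarrow> (real \<times> real) pmf"
  assumes "eprb_system P"
  shows "Delta0 P = (1/2) * (\<Sum>i=1..4. \<bar>meanV P i - meanW P i\<bar>) \<and>
         Delta_min P = (1/2) * max (2 * Delta0 P)
           (s_odd [corr P 1, corr P 2, corr P 3, corr P 4] - 2) \<and>
         CNTX P = (1/2) * max 0
           (s_odd [corr P 1, corr P 2, corr P 3, corr P 4] - 2
              - (\<Sum>i=1..4. \<bar>meanV P i - meanW P i\<bar>)) \<and>
         (noncontextual P \<longleftrightarrow>
           s_odd [corr P 1, corr P 2, corr P 3, corr P 4]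
             \<le> 2 + (\<Sum>i=1..4. \<bar>meanV P i - meanW P i\<bar>))"
proof -
  define s where "s = s_odd [corr P 1, corr P 2, corr P 3, corr P 4]"
  define D where "D S = (\<Sum>i=1..4. measure_pmf.prob S {(v, w). v i \<noteq> w i})"
    for S :: "((nat \<Rightarrow> real) \<times> (nat \<Rightarrow> real)) pmf"
  have D0: "Delta0 P = (\<Sum>i=1..4. \<bar>meanV P i - meanW P i\<bar> / 2)"
    by (simp add: Delta0_def sum_divide_distrib)
  have each: "\<bar>meanV P i - meanW P i\<bar> / 2 \<le> measure_pmf.prob S {(v, w). v i \<noteq> w i}"
    if "is_coupling P S" "i \<in> {1..4}" for S i
    unfolding prob_neq_map using coupling_of_prob_neq_ge[OF assms that(2) is_coupling_coupling_of[OF that]] .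
  have ge: "1/2 * max (2 * Delta0 P) (s - 2) \<le> D S" if "is_coupling P S" for S
  proof -
    have "Delta0 P \<le> D S" unfolding D0 D_def using each[OF that] by (intro sum_mono)
    moreover have "s \<le> 2 + 2 * D S" unfolding s_def D_def using is_coupling_s_odd_le[OF assms that] .
    ultimately show ?thesis by simp
  qed
  obtain S where S: "is_coupling P S" "D S \<le> 1/2 * max (2 * Delta0 P) (s - 2)"
    using optimal_coupling_exists[OF assms] unfolding D_def s_def by blast
  with ge have D_eq: "D S = 1/2 * max (2 * Delta0 P) (s - 2)" by (meson antisym)
  have "Delta_min P = Inf {D S | S. is_coupling P S}" by (simp add: Delta_min_def D_def)
  also have "\<dots> = 1/2 * max (2 * Delta0 P) (s - 2)"
    using S(1) D_eq ge by (intro cInf_eq_minimum) (auto intro: exI[of _ S])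
  finally have Dmin: "Delta_min P = 1/2 * max (2 * Delta0 P) (s - 2)" .
  \<comment> \<open>\<open>Delta0\<close> adds up four pairwise lower bounds, so equality of the
    totals forces equality in every pair, that is, maximality of all four couplings.\<close>
  have maximal_iff: "(\<forall>i\<in>{1..4}. maximal_coupling (distV P i) (distW P i) (map_pmf (\<lambda>(v, w). (v i, w i)) R)) \<longleftrightarrow>
      D R = Delta0 P" if "is_coupling P R" for R
  proof -
    have "D R = Delta0 P \<longleftrightarrow> (\<forall>i\<in>{1..4}. measure_pmf.prob R {(v, w). v i \<noteq> w i} = \<bar>meanV P i - meanW P i\<bar> / 2)"
    proof
      assume "D R = Delta0 P"
      thus "\<forall>i\<in>{1..4}. measure_pmf.prob R {(v, w). v i \<noteq> w i} = \<bar>meanV P i - meanW P i\<bar> / 2"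
        using sum_mono_inv[of "\<lambda>i. \<bar>meanV P i - meanW P i\<bar> / 2" "{1..4}"
            "\<lambda>i. measure_pmf.prob R {(v, w). v i \<noteq> w i}"] each[OF that]
        unfolding D_def D0 by force
    next
      assume "\<forall>i\<in>{1..4}. measure_pmf.prob R {(v, w). v i \<noteq> w i} = \<bar>meanV P i - meanW P i\<bar> / 2"
      thus "D R = Delta0 P" unfolding D_def D0 by (intro sum.cong refl) (rule bspec)
    qed
    thus ?thesis
      using maximal_coupling_iff[OF assms] is_coupling_coupling_of[OF that] unfolding prob_neq_map by blast
  qed
  \<comment> \<open>As the minimum is attained at \<open>S\<close>, noncontextuality means that it
    equals \<open>Delta0 P\<close>.\<close>
  have "noncontextual P \<longleftrightarrow> s \<le> 2 + 2 * Delta0 P"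
  proof
    assume "noncontextual P"
    then obtain R where "is_coupling P R" "D R = Delta0 P"
      using maximal_iff unfolding noncontextual_def by blast
    thus "s \<le> 2 + 2 * Delta0 P" using ge[of R] by simp
  next
    assume "s \<le> 2 + 2 * Delta0 P"
    hence "D S = Delta0 P" using D_eq by simp
    thus "noncontextual P" using maximal_iff S(1) unfolding noncontextual_def by blast
  qed
  thus ?thesis using Dmin unfolding s_def[symmetric] CNTX_def by (auto simp: Delta0_def max_def)
qed

end
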